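(* Let $F$ be a contravariant functor from the category of unital $C^*$-algebras to the category of sets whose restriction to the full subcategory of commutative unital $C^*$-algebras is isomorphic to the Gelfand spectrum functor $\operatorname{Gelf}$. Then $F(\mathrm{M}_n(\mathbb{C})) = \varnothing$ for every $n \geq 3$.
   Context: The morphisms of the category of unital $C^*$-algebras are identity-preserving $*$-homomorphisms. For a commutative unital $C^*$-algebra $A$, $\operatorname{Gelf}(A)$ is the set of maximal ideals of $A$; a morphism $f\colon A\to B$ is sent to the map $\operatorname{Gelf}(B)\to\operatorname{Gelf}(A)$, $M\mapsto f^{-1}(M)$. $\mathrm{M}_n(\mathbb{C})$ is the $C^*$-algebra of $n\times n$ complex matrices. *)

theory Defs
  imports "HOL-Analysis.Analysis" "HOL-Library.FuncSet"
begin

record 'a cstar_alg =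
  cset  :: "'a set"
  cadd  :: "'a \<Rightarrow> 'a \<Rightarrow> 'a"
  czero :: "'a"
  csmul :: "complex \<Rightarrow> 'a \<Rightarrow> 'a"
  cmul  :: "'a \<Rightarrow> 'a \<Rightarrow> 'a"
  cone  :: "'a"
  cinv  :: "'a \<Rightarrow> 'a"
  cnorm :: "'a \<Rightarrow> real"

definition csub :: "('a, 'm) cstar_alg_scheme \<Rightarrow> 'a \<Rightarrow> 'a \<Rightarrow> 'a" where
  "csub A x y = cadd A x (csmul A (-1) y)"

definition unital_cstar :: "('a, 'm) cstar_alg_scheme \<Rightarrow> bool" where
  "unital_cstar A \<longleftrightarrow>
     \<comment> \<open>closure\<close>
     czero A \<in> cset A \<and> cone A \<in> cset A \<and>
     (\<forall>x\<in>cset A. \<forall>y\<in>cset A. cadd A x y \<in> cset A \<and> cmul A x y \<in> cset A) \<and>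
     (\<forall>c. \<forall>x\<in>cset A. csmul A c x \<in> cset A) \<and>
     (\<forall>x\<in>cset A. cinv A x \<in> cset A) \<and>
     \<comment> \<open>complex vector space\<close>
     (\<forall>x\<in>cset A. \<forall>y\<in>cset A. \<forall>z\<in>cset A. cadd A (cadd A x y) z = cadd A x (cadd A y z)) \<and>
     (\<forall>x\<in>cset A. \<forall>y\<in>cset A. cadd A x y = cadd A y x) \<and>
     (\<forall>x\<in>cset A. cadd A (czero A) x = x) \<and>
     (\<forall>x\<in>cset A. cadd A x (csmul A (-1) x) = czero A) \<and>
     (\<forall>c. \<forall>x\<in>cset A. \<forall>y\<in>cset A. csmul A c (cadd A x y) = cadd A (csmul A c x) (csmul A c y)) \<and>
     (\<forall>c d. \<forall>x\<in>cset A. csmul A (c + d) x = cadd A (csmul A c x) (csmul A d x)) \<and>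
     (\<forall>c d. \<forall>x\<in>cset A. csmul A c (csmul A d x) = csmul A (c * d) x) \<and>
     (\<forall>x\<in>cset A. csmul A 1 x = x) \<and>
     \<comment> \<open>unital associative algebra\<close>
     (\<forall>x\<in>cset A. \<forall>y\<in>cset A. \<forall>z\<in>cset A. cmul A (cmul A x y) z = cmul A x (cmul A y z)) \<and>
     (\<forall>x\<in>cset A. \<forall>y\<in>cset A. \<forall>z\<in>cset A. cmul A (cadd A x y) z = cadd A (cmul A x z) (cmul A y z)) \<and>
     (\<forall>x\<in>cset A. \<forall>y\<in>cset A. \<forall>z\<in>cset A. cmul A x (cadd A y z) = cadd A (cmul A x y) (cmul A x z)) \<and>
     (\<forall>c. \<forall>x\<in>cset A. \<forall>y\<in>cset A. cmul A (csmul A c x) y = csmul A c (cmul A x y) \<and>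
                                    cmul A x (csmul A c y) = csmul A c (cmul A x y)) \<and>
     (\<forall>x\<in>cset A. cmul A (cone A) x = x \<and> cmul A x (cone A) = x) \<and>
     \<comment> \<open>norm (Banach algebra)\<close>
     (\<forall>x\<in>cset A. cnorm A x \<ge> 0 \<and> (cnorm A x = 0 \<longleftrightarrow> x = czero A)) \<and>
     (\<forall>x\<in>cset A. \<forall>y\<in>cset A. cnorm A (cadd A x y) \<le> cnorm A x + cnorm A y) \<and>
     (\<forall>c. \<forall>x\<in>cset A. cnorm A (csmul A c x) = cmod c * cnorm A x) \<and>
     (\<forall>x\<in>cset A. \<forall>y\<in>cset A. cnorm A (cmul A x y) \<le> cnorm A x * cnorm A y) \<and>
     (\<forall>X. (\<forall>k. X k \<in> cset A) \<and>
          (\<forall>e>0. \<exists>N::nat. \<forall>m\<ge>N. \<forall>k\<ge>N. cnorm A (csub A (X m) (X k)) < e) \<longrightarrow>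
          (\<exists>L\<in>cset A. \<forall>e>0. \<exists>N::nat. \<forall>k\<ge>N. cnorm A (csub A (X k) L) < e)) \<and>
     \<comment> \<open>involution\<close>
     (\<forall>x\<in>cset A. \<forall>y\<in>cset A. cinv A (cadd A x y) = cadd A (cinv A x) (cinv A y)) \<and>
     (\<forall>c. \<forall>x\<in>cset A. cinv A (csmul A c x) = csmul A (cnj c) (cinv A x)) \<and>
     (\<forall>x\<in>cset A. \<forall>y\<in>cset A. cinv A (cmul A x y) = cmul A (cinv A y) (cinv A x)) \<and>
     (\<forall>x\<in>cset A. cinv A (cinv A x) = x) \<and>
     \<comment> \<open>C*-identity\<close>
     (\<forall>x\<in>cset A. cnorm A (cmul A (cinv A x) x) = (cnorm A x)\<^sup>2)"

definition commutative_cstar :: "('a, 'm) cstar_alg_scheme \<Rightarrow> bool" where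
  "commutative_cstar A \<longleftrightarrow> unital_cstar A \<and>
     (\<forall>x\<in>cset A. \<forall>y\<in>cset A. cmul A x y = cmul A y x)"

definition cstar_hom :: "('a, 'm) cstar_alg_scheme \<Rightarrow> ('b, 'n) cstar_alg_scheme \<Rightarrow> ('a \<Rightarrow> 'b) set" where
  "cstar_hom A B = {f. f \<in> cset A \<rightarrow>\<^sub>E cset B \<and>
     (\<forall>x\<in>cset A. \<forall>y\<in>cset A. f (cadd A x y) = cadd B (f x) (f y)) \<and>
     (\<forall>c. \<forall>x\<in>cset A. f (csmul A c x) = csmul B c (f x)) \<and>
     (\<forall>x\<in>cset A. \<forall>y\<in>cset A. f (cmul A x y) = cmul B (f x) (f y)) \<and>
     (\<forall>x\<in>cset A. f (cinv A x) = cinv B (f x)) \<and>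
     f (cone A) = cone B}"

definition cstar_iso :: "('a, 'm) cstar_alg_scheme \<Rightarrow> ('b, 'n) cstar_alg_scheme \<Rightarrow> bool" where
  "cstar_iso A B \<longleftrightarrow> (\<exists>f\<in>cstar_hom A B. bij_betw f (cset A) (cset B))"

definition cstar_ideal :: "('a, 'm) cstar_alg_scheme \<Rightarrow> 'a set \<Rightarrow> bool" where
  "cstar_ideal A I \<longleftrightarrow> I \<subseteq> cset A \<and> czero A \<in> I \<and>
     (\<forall>x\<in>I. \<forall>y\<in>I. cadd A x y \<in> I) \<and>
     (\<forall>c. \<forall>x\<in>I. csmul A c x \<in> I) \<and>
     (\<forall>a\<in>cset A. \<forall>x\<in>I. cmul A a x \<in> I \<and> cmul A x a \<in> I)"

definition maximal_ideal :: "('a, 'm) cstar_alg_scheme \<Rightarrow> 'a set \<Rightarrow> bool" where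
  "maximal_ideal A M \<longleftrightarrow> cstar_ideal A M \<and> M \<noteq> cset A \<and>
     (\<forall>J. cstar_ideal A J \<and> M \<subseteq> J \<longrightarrow> J = M \<or> J = cset A)"

definition Gelf :: "('a, 'm) cstar_alg_scheme \<Rightarrow> 'a set set" where
  "Gelf A = {M. maximal_ideal A M}"

definition Gelf_map :: "('a, 'm) cstar_alg_scheme \<Rightarrow> ('a \<Rightarrow> 'a) \<Rightarrow> 'a set \<Rightarrow> 'a set" where
  "Gelf_map A f M = {x \<in> cset A. f x \<in> M}"

text \<open>The category of unital C*-algebras whose carriers live in the (arbitrary) type
\<^typ>\<open>'a\<close>; a contravariant functor to sets (of an arbitrary type \<^typ>\<open>'b\<close>) is given by
an object map \<open>Fo\<close> and a morphism map \<open>Fm A B f : Fo B \<rightarrow> Fo A\<close> for \<open>f : A \<rightarrow> B\<close>.\<close>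

definition contra_functor ::
  "('a cstar_alg \<Rightarrow> 'b set) \<Rightarrow> ('a cstar_alg \<Rightarrow> 'a cstar_alg \<Rightarrow> ('a \<Rightarrow> 'a) \<Rightarrow> 'b \<Rightarrow> 'b) \<Rightarrow> bool" where
  "contra_functor Fo Fm \<longleftrightarrow>
     (\<forall>A B f. unital_cstar A \<and> unital_cstar B \<and> f \<in> cstar_hom A B \<longrightarrow>
        (\<forall>x\<in>Fo B. Fm A B f x \<in> Fo A)) \<and>
     (\<forall>A. unital_cstar A \<longrightarrow> (\<forall>x\<in>Fo A. Fm A A (restrict id (cset A)) x = x)) \<and>
     (\<forall>A B C f g. unital_cstar A \<and> unital_cstar B \<and> unital_cstar C \<and>
        f \<in> cstar_hom A B \<and> g \<in> cstar_hom B C \<longrightarrow>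
        (\<forall>x\<in>Fo C. Fm A C (compose (cset A) g f) x = Fm A B f (Fm B C g x)))"

definition restricts_to_Gelf ::
  "('a cstar_alg \<Rightarrow> 'b set) \<Rightarrow> ('a cstar_alg \<Rightarrow> 'a cstar_alg \<Rightarrow> ('a \<Rightarrow> 'a) \<Rightarrow> 'b \<Rightarrow> 'b) \<Rightarrow> bool" where
  "restricts_to_Gelf Fo Fm \<longleftrightarrow>
     (\<exists>\<eta> :: 'a cstar_alg \<Rightarrow> 'b \<Rightarrow> 'a set.
        (\<forall>A. commutative_cstar A \<longrightarrow> bij_betw (\<eta> A) (Fo A) (Gelf A)) \<and>
        (\<forall>A B f. commutative_cstar A \<and> commutative_cstar B \<and> f \<in> cstar_hom A B \<longrightarrow>
           (\<forall>x\<in>Fo B. \<eta> A (Fm A B f x) = Gelf_map A f (\<eta> B x))))"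

definition vec_norm :: "nat \<Rightarrow> (nat \<Rightarrow> complex) \<Rightarrow> real" where
  "vec_norm n v = sqrt (\<Sum>j<n. (cmod (v j))\<^sup>2)"

definition mat_alg :: "nat \<Rightarrow> (nat \<Rightarrow> nat \<Rightarrow> complex) cstar_alg" where
  "mat_alg n = \<lparr>
     cset = {M. \<forall>i j. (n \<le> i \<or> n \<le> j) \<longrightarrow> M i j = 0},
     cadd = (\<lambda>M N i j. M i j + N i j),
     czero = (\<lambda>i j. 0),
     csmul = (\<lambda>c M i j. c * M i j),
     cmul = (\<lambda>M N i k. if i < n \<and> k < n then \<Sum>j<n. M i j * N j k else 0),
     cone = (\<lambda>i j. if i = j \<and> i < n then 1 else 0),
     cinv = (\<lambda>M i j. if i < n \<and> j < n then cnj (M j i) else 0),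
     cnorm = (\<lambda>M. SUP v\<in>{v. vec_norm n v \<le> 1}. vec_norm n (\<lambda>i. \<Sum>j<n. M i j * v j)) \<rparr>"

end

theory Submission
  imports Defs
begin

text \<open>A point of \<open>F A\<close> restricts to a maximal ideal of every commutative C*-subalgebra of \<open>A\<close>,
compatibly with inclusions. Every commuting family of self-adjoint elements lies in a commutative
C*-subalgebra, so calling a self-adjoint element true when it lies outside these ideals gives a
well-defined colouring: of two elements with product 0 at most one is true (maximal ideals are
prime), and if a sum of commuting elements is true then so is one of the summands. Some diagonal
matrix unit \<open>e\<^sub>i\<close> is true, hence so is the projection onto any three coordinate axes including the
\<open>i\<close>-th, and the colouring restricts to a Kochen-Specker colouring of the rays in that
three-dimensional space, which does not exist.\<close>

section \<open>Commutative subalgebras and maximal ideals\<close>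

locale unital_cstar_algebra =
  fixes A :: "'a cstar_alg"
  assumes unital_cstar: "unital_cstar A"
begin

section \<open>Elementary algebra and norm rules in a unital C*-algebra\<close>

lemma zero_closed [simp]: "czero A \<in> cset A"
  and one_closed [simp]: "cone A \<in> cset A"
  using unital_cstar unfolding unital_cstar_def ball_conj_distrib all_conj_distrib by - (elim conjE, assumption)+

lemma add_closed [rule_format, simp]: "\<forall>x\<in>cset A. \<forall>y\<in>cset A. cadd A x y \<in> cset A"
  and mul_closed [rule_format, simp]: "\<forall>x\<in>cset A. \<forall>y\<in>cset A. cmul A x y \<in> cset A"
  and smul_closed [rule_format, simp]: "\<forall>c. \<forall>x\<in>cset A. csmul A c x \<in> cset A"
  and inv_closed [rule_format, simp]: "\<forall>x\<in>cset A. cinv A x \<in> cset A"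
  using unital_cstar unfolding unital_cstar_def ball_conj_distrib all_conj_distrib by - (elim conjE, assumption)+

lemma add_assoc [rule_format]: "\<forall>x\<in>cset A. \<forall>y\<in>cset A. \<forall>z\<in>cset A. cadd A (cadd A x y) z = cadd A x (cadd A y z)"
  and add_commute [rule_format]: "\<forall>x\<in>cset A. \<forall>y\<in>cset A. cadd A x y = cadd A y x"
  and add_zero_left [rule_format, simp]: "\<forall>x\<in>cset A. cadd A (czero A) x = x"
  and add_neg [rule_format, simp]: "\<forall>x\<in>cset A. cadd A x (csmul A (-1) x) = czero A"
  using unital_cstar unfolding unital_cstar_def ball_conj_distrib all_conj_distrib by - (elim conjE, assumption)+

lemma smul_add_right [rule_format]: "\<forall>c. \<forall>x\<in>cset A. \<forall>y\<in>cset A. csmul A c (cadd A x y) = cadd A (csmul A c x) (csmul A c y)"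
  and smul_add_left [rule_format]: "\<forall>c d. \<forall>x\<in>cset A. csmul A (c + d) x = cadd A (csmul A c x) (csmul A d x)"
  and smul_smul [rule_format, simp]: "\<forall>c d. \<forall>x\<in>cset A. csmul A c (csmul A d x) = csmul A (c * d) x"
  and smul_one [rule_format, simp]: "\<forall>x\<in>cset A. csmul A 1 x = x"
  using unital_cstar unfolding unital_cstar_def ball_conj_distrib all_conj_distrib by - (elim conjE, assumption)+

lemma mul_assoc [rule_format]: "\<forall>x\<in>cset A. \<forall>y\<in>cset A. \<forall>z\<in>cset A. cmul A (cmul A x y) z = cmul A x (cmul A y z)"
  and mul_add_left [rule_format]: "\<forall>x\<in>cset A. \<forall>y\<in>cset A. \<forall>z\<in>cset A. cmul A (cadd A x y) z = cadd A (cmul A x z) (cmul A y z)"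
  and mul_add_right [rule_format]: "\<forall>x\<in>cset A. \<forall>y\<in>cset A. \<forall>z\<in>cset A. cmul A x (cadd A y z) = cadd A (cmul A x y) (cmul A x z)"
  and mul_smul_left [rule_format]: "\<forall>c. \<forall>x\<in>cset A. \<forall>y\<in>cset A. cmul A (csmul A c x) y = csmul A c (cmul A x y)"
  and mul_smul_right [rule_format]: "\<forall>c. \<forall>x\<in>cset A. \<forall>y\<in>cset A. cmul A x (csmul A c y) = csmul A c (cmul A x y)"
  and mul_one_left [rule_format, simp]: "\<forall>x\<in>cset A. cmul A (cone A) x = x"
  and mul_one_right [rule_format, simp]: "\<forall>x\<in>cset A. cmul A x (cone A) = x"
  using unital_cstar unfolding unital_cstar_def ball_conj_distrib all_conj_distrib by - (elim conjE, assumption)+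

lemma norm_nonneg [rule_format, simp]: "\<forall>x\<in>cset A. cnorm A x \<ge> 0"
  and norm_eq_zero [rule_format, simp]: "\<forall>x\<in>cset A. cnorm A x = 0 \<longleftrightarrow> x = czero A"
  and norm_triangle [rule_format]: "\<forall>x\<in>cset A. \<forall>y\<in>cset A. cnorm A (cadd A x y) \<le> cnorm A x + cnorm A y"
  and norm_smul [rule_format, simp]: "\<forall>c. \<forall>x\<in>cset A. cnorm A (csmul A c x) = cmod c * cnorm A x"
  and norm_mul [rule_format]: "\<forall>x\<in>cset A. \<forall>y\<in>cset A. cnorm A (cmul A x y) \<le> cnorm A x * cnorm A y"
  using unital_cstar unfolding unital_cstar_def ball_conj_distrib all_conj_distrib by - (elim conjE, assumption)+

lemma complete:
  assumes "\<And>k. X k \<in> cset A"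
    and "\<forall>e>0. \<exists>N::nat. \<forall>m\<ge>N. \<forall>k\<ge>N. cnorm A (csub A (X m) (X k)) < e"
  shows "\<exists>L\<in>cset A. \<forall>e>0. \<exists>N::nat. \<forall>k\<ge>N. cnorm A (csub A (X k) L) < e"
proof -
  have "\<forall>X. (\<forall>k. X k \<in> cset A) \<and>
          (\<forall>e>0. \<exists>N::nat. \<forall>m\<ge>N. \<forall>k\<ge>N. cnorm A (csub A (X m) (X k)) < e) \<longrightarrow>
          (\<exists>L\<in>cset A. \<forall>e>0. \<exists>N::nat. \<forall>k\<ge>N. cnorm A (csub A (X k) L) < e)"
    using unital_cstar unfolding unital_cstar_def by (elim conjE)
  with assms show ?thesis by blast
qed

lemma inv_add [rule_format]: "\<forall>x\<in>cset A. \<forall>y\<in>cset A. cinv A (cadd A x y) = cadd A (cinv A x) (cinv A y)"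
  and inv_smul [rule_format]: "\<forall>c. \<forall>x\<in>cset A. cinv A (csmul A c x) = csmul A (cnj c) (cinv A x)"
  and inv_mul [rule_format]: "\<forall>x\<in>cset A. \<forall>y\<in>cset A. cinv A (cmul A x y) = cmul A (cinv A y) (cinv A x)"
  and inv_inv [rule_format, simp]: "\<forall>x\<in>cset A. cinv A (cinv A x) = x"
  and cstar_identity [rule_format]: "\<forall>x\<in>cset A. cnorm A (cmul A (cinv A x) x) = (cnorm A x)\<^sup>2"
  using unital_cstar unfolding unital_cstar_def ball_conj_distrib all_conj_distrib by - (elim conjE, assumption)+

lemma add_zero_right [simp]: "x \<in> cset A \<Longrightarrow> cadd A x (czero A) = x"
  by (simp add: add_commute[of x])

lemma smul_zero_left [simp]: "x \<in> cset A \<Longrightarrow> csmul A 0 x = czero A"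
  using smul_add_left[of x 1 "-1"] by simp

lemma smul_zero_right [simp]: "csmul A c (czero A) = czero A"
  using smul_smul[of "czero A" c 0] by simp

lemma mul_zero_left [simp]: "x \<in> cset A \<Longrightarrow> cmul A (czero A) x = czero A"
  using mul_smul_left[of "czero A" x 0] by simp

lemma mul_zero_right [simp]: "x \<in> cset A \<Longrightarrow> cmul A x (czero A) = czero A"
  using mul_smul_right[of x "czero A" 0] by simp

lemma inv_zero [simp]: "cinv A (czero A) = czero A"
  using inv_smul[of "czero A" 0] by simp

lemma inv_one [simp]: "cinv A (cone A) = cone A"
  using inv_mul[of "cone A" "cinv A (cone A)"] by simp

lemma add_left_commute:
  "\<lbrakk>x \<in> cset A; y \<in> cset A; z \<in> cset A\<rbrakk> \<Longrightarrow> cadd A x (cadd A y z) = cadd A y (cadd A x z)"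
  by (metis add_assoc add_commute)

lemma sub_closed [simp]: "\<lbrakk>x \<in> cset A; y \<in> cset A\<rbrakk> \<Longrightarrow> csub A x y \<in> cset A"
  by (simp add: csub_def)

lemma sub_eq_zero: "\<lbrakk>x \<in> cset A; y \<in> cset A; csub A x y = czero A\<rbrakk> \<Longrightarrow> x = y"
  unfolding csub_def
  by (metis add_assoc add_commute add_neg add_zero_left smul_closed add_zero_right)

lemma add_sub_sub:
  assumes "x \<in> cset A" "y \<in> cset A" "z \<in> cset A"
  shows "cadd A (csub A x y) (csub A y z) = csub A x z"
proof -
  have "cadd A (csub A x y) (csub A y z)
      = cadd A x (cadd A (cadd A y (csmul A (-1) y)) (csmul A (-1) z))"
    using assms by (simp add: csub_def add_assoc add_left_commute del: add_neg)
  with assms show ?thesis by (simp add: csub_def)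
qed

lemma norm_sub_commute: "\<lbrakk>x \<in> cset A; y \<in> cset A\<rbrakk> \<Longrightarrow> cnorm A (csub A x y) = cnorm A (csub A y x)"
proof -
  assume "x \<in> cset A" "y \<in> cset A"
  then have "csub A x y = csmul A (-1) (csub A y x)"
    by (simp add: csub_def smul_add_right add_commute)
  with \<open>x \<in> cset A\<close> \<open>y \<in> cset A\<close> show ?thesis by simp
qed

section \<open>Commutants as C*-subalgebras\<close>

definition commutant :: "'a set \<Rightarrow> 'a set" where
  "commutant S = {x \<in> cset A. \<forall>s\<in>S. cmul A x s = cmul A s x}"

lemma commutant_subset: "commutant S \<subseteq> cset A"
  by (auto simp: commutant_def)

lemma commutant_antimono: "S \<subseteq> T \<Longrightarrow> commutant T \<subseteq> commutant S"
  by (auto simp: commutant_def)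

lemma subset_commutant_commutant: "S \<subseteq> cset A \<Longrightarrow> S \<subseteq> commutant (commutant S)"
  by (auto simp: commutant_def)

text \<open>Since \<open>S\<close> is closed under the involution, \<open>x\<close> commutes with
  \<open>cinv A s\<close>; taking adjoints of that equation shows that \<open>cinv A x\<close>
  commutes with \<open>s\<close>.\<close>

lemma inv_commutant:
  assumes "S \<subseteq> cset A" "\<And>s. s \<in> S \<Longrightarrow> cinv A s \<in> S" "x \<in> commutant S"
  shows "cinv A x \<in> commutant S"
proof -
  have "cmul A (cinv A x) s = cmul A s (cinv A x)" if "s \<in> S" for s
  proof -
    have "s \<in> cset A" "x \<in> cset A" "cmul A x (cinv A s) = cmul A (cinv A s) x"
      using that assms by (auto simp: commutant_def)
    then show ?thesis by (metis inv_mul inv_inv inv_closed)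
  qed
  with assms show ?thesis by (auto simp: commutant_def)
qed

text \<open>Multiplication is norm continuous, so commuting with a fixed \<open>s\<close> survives
  limits: the commutator of \<open>L\<close> and \<open>s\<close> has norm at most twice
  \<open>cnorm A s\<close> times the distance from \<open>X k\<close> to \<open>L\<close>.\<close>

lemma limit_in_commutant:
  assumes S: "S \<subseteq> cset A" and X: "\<And>k::nat. X k \<in> commutant S" and L: "L \<in> cset A"
    and lim: "\<forall>e>0. \<exists>N. \<forall>k\<ge>N. cnorm A (csub A (X k) L) < e"
  shows "L \<in> commutant S"
proof -
  have "cmul A L s = cmul A s L" if "s \<in> S" for s
  proof -
    have s: "s \<in> cset A" using that S by blast
    have Xc: "X k \<in> cset A" "cmul A (X k) s = cmul A s (X k)" for k
      using X[of k] that by (auto simp: commutant_def)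
    let ?d = "csub A (cmul A L s) (cmul A s L)"
    have bound: "cnorm A ?d \<le> 2 * cnorm A s * cnorm A (csub A (X k) L)" for k
    proof -
      \<comment> \<open>The common value of \<open>cmul A (X k) s\<close> and
        \<open>cmul A s (X k)\<close> is inserted between the two products.\<close>
      have "?d = cadd A (csub A (cmul A L s) (cmul A (X k) s)) (csub A (cmul A s (X k)) (cmul A s L))"
        using s L Xc by (simp add: add_sub_sub)
      also have "\<dots> = cadd A (cmul A (csub A L (X k)) s) (cmul A s (csub A (X k) L))"
        using s L Xc by (simp add: csub_def mul_add_left mul_add_right mul_smul_left mul_smul_right)
      also have "cnorm A \<dots> \<le> cnorm A (cmul A (csub A L (X k)) s) + cnorm A (cmul A s (csub A (X k) L))"
        using s L Xc by (simp add: norm_triangle)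
      also have "\<dots> \<le> cnorm A (csub A L (X k)) * cnorm A s + cnorm A s * cnorm A (csub A (X k) L)"
        using s L Xc by (intro add_mono norm_mul) auto
      also have "cnorm A (csub A L (X k)) = cnorm A (csub A (X k) L)"
        using L Xc by (simp add: norm_sub_commute)
      finally show ?thesis by (simp add: algebra_simps)
    qed
    have "cnorm A ?d \<le> 0"
    proof (rule field_le_epsilon)
      fix e :: real assume "e > 0"
      \<comment> \<open>The summand 1 keeps \<open>c\<close> positive even when \<open>s\<close> has
        norm 0, so that \<open>e / c\<close> is a legitimate tolerance.\<close>
      define c where "c = 2 * cnorm A s + 1"
      have "c > 0" using norm_nonneg[OF s] unfolding c_def by linarith
      then have "e / c > 0" using \<open>e > 0\<close> by simp
      with lim obtain k where k: "cnorm A (csub A (X k) L) < e / c" by blast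
      have "cnorm A ?d \<le> 2 * cnorm A s * cnorm A (csub A (X k) L)" by (rule bound)
      also have "\<dots> \<le> c * cnorm A (csub A (X k) L)"
        using s L Xc by (intro mult_right_mono) (auto simp: c_def)
      also have "\<dots> \<le> e" using k \<open>c > 0\<close> by (simp add: field_simps)
      finally show "cnorm A ?d \<le> 0 + e" by simp
    qed
    then have "?d = czero A"
      using s L by (metis norm_eq_zero norm_nonneg sub_closed mul_closed antisym)
    with s L show ?thesis by (simp add: sub_eq_zero)
  qed
  with L show ?thesis by (simp add: commutant_def)
qed

text \<open>Equations and norm estimates are inherited from \<open>A\<close>; only closure under the
  operations and completeness need an argument, the latter by
  \<open>limit_in_commutant\<close>.\<close>

lemma unital_cstar_commutant:
  assumes S: "S \<subseteq> cset A" "\<And>s. s \<in> S \<Longrightarrow> cinv A s \<in> S"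
  shows "unital_cstar (A\<lparr>cset := commutant S\<rparr>)"
proof -
  have c: "x \<in> cset A" if "x \<in> commutant S" for x
    using that by (simp add: commutant_def)
  have SA: "s \<in> cset A" if "s \<in> S" for s using that S by blast
  have clos: "czero A \<in> commutant S" "cone A \<in> commutant S"
    "\<And>x y. x \<in> commutant S \<Longrightarrow> y \<in> commutant S \<Longrightarrow> cadd A x y \<in> commutant S"
    "\<And>k x. x \<in> commutant S \<Longrightarrow> csmul A k x \<in> commutant S"
    using SA by (auto simp: commutant_def mul_add_left mul_add_right mul_smul_left mul_smul_right)
  have mul: "cmul A x y \<in> commutant S" if "x \<in> commutant S" "y \<in> commutant S" for x y
  proof -
    have "cmul A (cmul A x y) s = cmul A s (cmul A x y)" if "s \<in> S" for s
      using that \<open>x \<in> _\<close> \<open>y \<in> _\<close> SA[OF that] unfolding commutant_def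
      by (smt (verit) mem_Collect_eq mul_assoc)
    with that show ?thesis by (simp add: commutant_def)
  qed
  have compl: "\<exists>L\<in>commutant S. \<forall>e>0. \<exists>N. \<forall>k\<ge>N. cnorm A (csub A (X k) L) < e"
    if "\<forall>k. X k \<in> commutant S"
      "\<forall>e>0. \<exists>N::nat. \<forall>m\<ge>N. \<forall>k\<ge>N. cnorm A (csub A (X m) (X k)) < e" for X
    using complete[of X] limit_in_commutant[OF S(1), of X] that c by blast
  have csub: "csub (A\<lparr>cset := commutant S\<rparr>) = csub A"
    by (simp add: csub_def fun_eq_iff)
  show ?thesis
    unfolding unital_cstar_def csub
    by (intro conjI allI ballI impI; (elim conjE)?)
       (simp_all add: c clos mul compl inv_commutant[OF S] add_assoc smul_add_right
         smul_add_left mul_assoc mul_add_left mul_add_right mul_smul_left mul_smul_right norm_triangle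
         norm_mul inv_add inv_smul inv_mul cstar_identity add_commute add_left_commute)
qed

section \<open>Maximal ideals are proper and, in the commutative case, prime\<close>

lemma maximal_ideal_one:
  assumes "maximal_ideal A M"
  shows "cone A \<notin> M"
proof
  assume "cone A \<in> M"
  then have "x \<in> M" if "x \<in> cset A" for x
    using assms that mul_one_right[OF that] unfolding maximal_ideal_def cstar_ideal_def by metis
  moreover have "M \<subseteq> cset A" "M \<noteq> cset A"
    using assms by (simp_all add: maximal_ideal_def cstar_ideal_def)
  ultimately show False by blast
qed

text \<open>If \<open>x\<close> is not in \<open>M\<close>, then the ideal \<open>M + xA\<close> is
  strictly larger than \<open>M\<close>, so it contains the unit: 1 = m + xa. Multiplying by
  \<open>y\<close> gives y = my + a(xy), and both summands lie in \<open>M\<close>.\<close>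

lemma maximal_ideal_prime:
  assumes comm: "\<And>x y. x \<in> cset A \<Longrightarrow> y \<in> cset A \<Longrightarrow> cmul A x y = cmul A y x"
    and M: "maximal_ideal A M" and xy: "x \<in> cset A" "y \<in> cset A" "cmul A x y \<in> M"
  shows "x \<in> M \<or> y \<in> M"
proof (rule ccontr)
  assume neg: "\<not> (x \<in> M \<or> y \<in> M)"
  have Mi: "cstar_ideal A M" using M by (simp add: maximal_ideal_def)
  then have MA: "m \<in> cset A" if "m \<in> M" for m using that by (auto simp: cstar_ideal_def)
  define J where "J = {cadd A m (cmul A x a) | m a. m \<in> M \<and> a \<in> cset A}"
  have JI: "z \<in> J" if "z = cadd A m (cmul A x a)" "m \<in> M" "a \<in> cset A" for z m a
    using that by (auto simp: J_def)
  have MJ: "M \<subseteq> J"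
  proof
    fix m assume "m \<in> M"
    then show "m \<in> J"
      using MA xy by (intro JI[of m m "czero A"]) auto
  qed
  have xJ: "x \<in> J"
    using Mi xy by (intro JI[where a = "cone A" and m = "czero A"]) (auto simp: cstar_ideal_def)
  have "cstar_ideal A J"
    unfolding cstar_ideal_def
  proof (intro conjI ballI allI)
    show "J \<subseteq> cset A" using MA xy by (auto simp: J_def)
    show "czero A \<in> J" using MJ Mi by (auto simp: cstar_ideal_def)
  next
    fix u v assume "u \<in> J" "v \<in> J"
    then obtain m a m' a' where *: "u = cadd A m (cmul A x a)" "v = cadd A m' (cmul A x a')"
      "m \<in> M" "m' \<in> M" "a \<in> cset A" "a' \<in> cset A" by (auto simp: J_def)
    then have "cadd A u v = cadd A (cadd A m m') (cmul A x (cadd A a a'))"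
      using MA xy by (simp add: mul_add_right add_assoc add_left_commute)
    then show "cadd A u v \<in> J" by (rule JI) (use * Mi in \<open>auto simp: cstar_ideal_def\<close>)
  next
    fix c u assume "u \<in> J"
    then obtain m a where *: "u = cadd A m (cmul A x a)" "m \<in> M" "a \<in> cset A" by (auto simp: J_def)
    then have "csmul A c u = cadd A (csmul A c m) (cmul A x (csmul A c a))"
      using MA xy by (simp add: smul_add_right mul_smul_right)
    then show "csmul A c u \<in> J" by (rule JI) (use * Mi in \<open>auto simp: cstar_ideal_def\<close>)
  next
    fix b u assume b: "b \<in> cset A" and "u \<in> J"
    then obtain m a where *: "u = cadd A m (cmul A x a)" "m \<in> M" "a \<in> cset A" by (auto simp: J_def)
    then have "cmul A u b = cadd A (cmul A m b) (cmul A x (cmul A a b))"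
      using MA xy b by (simp add: mul_add_left mul_assoc)
    then show "cmul A u b \<in> J" by (rule JI) (use * Mi b in \<open>auto simp: cstar_ideal_def\<close>)
    then show "cmul A b u \<in> J" using comm[of b u] b * MA xy by simp
  qed
  with M MJ xJ neg have "J = cset A" unfolding maximal_ideal_def by blast
  then have "cone A \<in> J" by simp
  then obtain m a where *: "cone A = cadd A m (cmul A x a)" "m \<in> M" "a \<in> cset A" by (auto simp: J_def)
  have "y = cmul A (cadd A m (cmul A x a)) y" using xy by (simp flip: *(1))
  also have "\<dots> = cadd A (cmul A m y) (cmul A a (cmul A x y))"
    using * MA xy by (simp add: mul_add_left comm[of x a] mul_assoc)
  also have "\<dots> \<in> M" using * Mi xy by (simp add: cstar_ideal_def)
  finally show False using neg by simp
qed

section \<open>Commuting self-adjoint families and their bicommutants\<close>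

definition selfadjoint :: "'a \<Rightarrow> bool" where
  "selfadjoint x \<longleftrightarrow> x \<in> cset A \<and> cinv A x = x"

definition commuting :: "'a set \<Rightarrow> bool" where
  "commuting S \<longleftrightarrow> (\<forall>s\<in>S. selfadjoint s) \<and> (\<forall>s\<in>S. \<forall>t\<in>S. cmul A s t = cmul A t s)"

text \<open>Commutants are automatically norm closed, so the bicommutant replaces the generated C*-algebra
without any need to take closures.\<close>

definition bicommutant_alg :: "'a set \<Rightarrow> 'a cstar_alg" where
  "bicommutant_alg S = A\<lparr>cset := commutant (commutant S)\<rparr>"

lemma bicommutant_alg_simps [simp]:
  "cset (bicommutant_alg S) = commutant (commutant S)" "cadd (bicommutant_alg S) = cadd A"
  "czero (bicommutant_alg S) = czero A" "csmul (bicommutant_alg S) = csmul A"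
  "cmul (bicommutant_alg S) = cmul A" "cone (bicommutant_alg S) = cone A"
  "cinv (bicommutant_alg S) = cinv A"
  by (simp_all add: bicommutant_alg_def)

lemma commuting_subset: "commuting S \<Longrightarrow> S \<subseteq> cset A"
  by (auto simp: commuting_def selfadjoint_def)

text \<open>A commuting \<open>S\<close> lies in its commutant, so the bicommutant does too.
  Elements of the bicommutant commute with everything in the commutant, hence with each
  other.\<close>

lemma commutative_bicommutant:
  assumes "commuting S"
  shows "commutative_cstar (bicommutant_alg S)"
proof -
  have S: "S \<subseteq> cset A" "\<And>s. s \<in> S \<Longrightarrow> cinv A s \<in> S"
    using assms by (auto simp: commuting_def selfadjoint_def)
  have "unital_cstar (bicommutant_alg S)"
    unfolding bicommutant_alg_def
    by (rule unital_cstar_commutant[OF commutant_subset]) (rule inv_commutant[OF S])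
  moreover have "S \<subseteq> commutant S"
    using assms S by (auto simp: commuting_def commutant_def)
  then have "commutant (commutant S) \<subseteq> commutant S" by (rule commutant_antimono)
  then have "cmul A x y = cmul A y x"
    if "x \<in> commutant (commutant S)" "y \<in> commutant (commutant S)" for x y
    using that unfolding commutant_def[of "commutant S"] by blast
  ultimately show ?thesis by (simp add: commutative_cstar_def)
qed

text \<open>Membership of \<open>p\<close> says that everything commuting with \<open>S\<close>
  commutes with \<open>p\<close>; taking commutants reverses this inclusion.\<close>

lemma bicommutant_mono:
  assumes "p \<in> commutant (commutant S)"
  shows "commutant (commutant {p}) \<subseteq> commutant (commutant S)"
proof (rule commutant_antimono)
  show "commutant S \<subseteq> commutant {p}"
    using assms by (auto simp: commutant_def[of "commutant S"]) (auto simp: commutant_def)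
qed

text \<open>These inclusions are the morphisms along which a point of \<open>Fo A\<close> is
  restricted. They are written with \<open>restrict\<close> because \<open>cstar_hom\<close>
  consists of extensional functions.\<close>

lemma inclusion_hom:
  assumes "commutant (commutant S) \<subseteq> commutant (commutant T)" "commuting S"
  shows "restrict id (commutant (commutant S)) \<in> cstar_hom (bicommutant_alg S) (bicommutant_alg T)"
    and "restrict id (commutant (commutant S)) \<in> cstar_hom (bicommutant_alg S) A"
proof -
  interpret B: unital_cstar_algebra "bicommutant_alg S"
    using commutative_bicommutant[OF assms(2)]
    by unfold_locales (simp add: commutative_cstar_def)
  show "restrict id (commutant (commutant S)) \<in> cstar_hom (bicommutant_alg S) (bicommutant_alg T)"
    "restrict id (commutant (commutant S)) \<in> cstar_hom (bicommutant_alg S) A"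
    using assms(1) commutant_subset[of "commutant S"]
      B.one_closed B.add_closed B.mul_closed B.smul_closed B.inv_closed
    by (auto simp: cstar_hom_def)
qed

lemma commuting_singleton: "selfadjoint p \<Longrightarrow> commuting {p}"
  by (simp add: commuting_def)

lemma commuting_pair:
  "\<lbrakk>selfadjoint p; selfadjoint q; cmul A p q = cmul A q p\<rbrakk> \<Longrightarrow> commuting {p, q}"
  by (simp add: commuting_def)

lemma selfadjoint_add: "\<lbrakk>selfadjoint p; selfadjoint q\<rbrakk> \<Longrightarrow> selfadjoint (cadd A p q)"
  by (simp add: selfadjoint_def inv_add)

lemma selfadjoint_mul:
  "\<lbrakk>selfadjoint p; selfadjoint q; cmul A p q = cmul A q p\<rbrakk> \<Longrightarrow> selfadjoint (cmul A p q)"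
  by (simp add: selfadjoint_def inv_mul)

text \<open>Each rule is read off from one maximal ideal \<open>M {p, q}\<close>: it is prime (first
  rule), closed under sums (second) and absorbs products (third). The last two facts hold because a
  maximal ideal is proper and contains zero.\<close>

lemma spectrum_point_colouring:
  fixes Fo :: "'a cstar_alg \<Rightarrow> 'b set"
  assumes F: "contra_functor Fo Fm" and G: "restricts_to_Gelf Fo Fm" and x: "x \<in> Fo A"
  obtains h :: "'a \<Rightarrow> bool" where
    "\<And>p q. \<lbrakk>selfadjoint p; selfadjoint q; cmul A p q = czero A; cmul A q p = czero A\<rbrakk> \<Longrightarrow> \<not> (h p \<and> h q)"
    "\<And>p q. \<lbrakk>selfadjoint p; selfadjoint q; cmul A p q = cmul A q p; h (cadd A p q)\<rbrakk> \<Longrightarrow> h p \<or> h q"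
    "\<And>p q. \<lbrakk>selfadjoint p; selfadjoint q; cmul A p q = cmul A q p; h (cmul A p q)\<rbrakk> \<Longrightarrow> h p"
    "h (cone A)" "\<not> h (czero A)"
proof -
  from G obtain \<eta> :: "'a cstar_alg \<Rightarrow> 'b \<Rightarrow> 'a set" where
    bij: "\<And>B. commutative_cstar B \<Longrightarrow> bij_betw (\<eta> B) (Fo B) (Gelf B)" and
    nat: "\<And>B C f y. \<lbrakk>commutative_cstar B; commutative_cstar C; f \<in> cstar_hom B C; y \<in> Fo C\<rbrakk>
      \<Longrightarrow> \<eta> B (Fm B C f y) = Gelf_map B f (\<eta> C y)"
    unfolding restricts_to_Gelf_def by blast
  have Fm: "Fm B C f y \<in> Fo B" if "unital_cstar B" "unital_cstar C" "f \<in> cstar_hom B C" "y \<in> Fo C" for B C f y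
    using F that unfolding contra_functor_def by blast
  have Fcomp: "Fm B D (compose (cset B) g f) y = Fm B C f (Fm C D g y)"
    if "unital_cstar B" "unital_cstar C" "unital_cstar D" "f \<in> cstar_hom B C" "g \<in> cstar_hom C D" "y \<in> Fo D"
    for B C D f g y
    using F that unfolding contra_functor_def by blast
  let ?i = "\<lambda>S. restrict id (commutant (commutant S))"
  let ?x = "\<lambda>S. Fm (bicommutant_alg S) A (?i S) x"
  define M where "M S = \<eta> (bicommutant_alg S) (?x S)" for S
  \<comment> \<open>A self-adjoint \<open>p\<close> is judged in its own bicommutant; \<open>consistent\<close> below shows that any larger
    commutative bicommutant gives the same answer.\<close>
  define h where "h p \<longleftrightarrow> p \<notin> M {p}" for p
  have unital: "unital_cstar (bicommutant_alg S)" if "commuting S" for S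
    using commutative_bicommutant[OF that] by (simp add: commutative_cstar_def)
  have xS: "?x S \<in> Fo (bicommutant_alg S)" if "commuting S" for S
    by (rule Fm[OF unital[OF that] unital_cstar inclusion_hom(2)[OF order_refl that] x])
  have maxM: "maximal_ideal (bicommutant_alg S) (M S)" if "commuting S" for S
    using bij_betwE[OF bij[OF commutative_bicommutant[OF that]]] xS[OF that]
    by (auto simp: M_def Gelf_def)
  have consistent: "h p \<longleftrightarrow> p \<notin> M S"
    if S: "commuting S" and p: "p \<in> commutant (commutant S)" "selfadjoint p" for S p
  proof -
    note c = commuting_singleton[OF p(2)]
    note sub = bicommutant_mono[OF p(1)]
    \<comment> \<open>The inclusion of the bicommutant of \<open>{p}\<close> into \<open>A\<close>
      factors through that of \<open>S\<close>. Functoriality then expresses \<open>?x {p}\<close>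
      through \<open>?x S\<close>, and naturality of \<open>\<eta>\<close> makes
      \<open>M {p}\<close> the preimage of \<open>M S\<close>.\<close>
    have "compose (commutant (commutant {p})) (?i S) (?i {p}) = ?i {p}"
      using sub by (auto simp: compose_def fun_eq_iff restrict_def)
    then have "?x {p} = Fm (bicommutant_alg {p}) (bicommutant_alg S) (?i {p}) (?x S)"
      using Fcomp[OF unital[OF c] unital[OF S] unital_cstar inclusion_hom(1)[OF sub c]
          inclusion_hom(2)[OF order_refl S] x] by simp
    then have "M {p} = Gelf_map (bicommutant_alg {p}) (?i {p}) (M S)"
      unfolding M_def using nat[OF commutative_bicommutant[OF c] commutative_bicommutant[OF S]
          inclusion_hom(1)[OF sub c] xS[OF S]] by simp
    moreover have "p \<in> commutant (commutant {p})"
      using subset_commutant_commutant[of "{p}"] p by (simp add: selfadjoint_def)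
    ultimately show ?thesis by (simp add: h_def Gelf_map_def)
  qed
  have pair: "p \<in> commutant (commutant {p, q})" "q \<in> commutant (commutant {p, q})"
    if "commuting {p, q}" for p q
    using subset_commutant_commutant[OF commuting_subset[OF that]] by auto
  show thesis
  proof (rule that[of h])
    fix p q
    assume pq: "selfadjoint p" "selfadjoint q" "cmul A p q = czero A" "cmul A q p = czero A"
    then have S: "commuting {p, q}" by (simp add: commuting_pair)
    interpret B: unital_cstar_algebra "bicommutant_alg {p, q}"
      using unital[OF S] by unfold_locales
    have "czero A \<in> M {p, q}" using maxM[OF S] by (simp add: maximal_ideal_def cstar_ideal_def)
    then have "p \<in> M {p, q} \<or> q \<in> M {p, q}"
      using B.maximal_ideal_prime[OF _ maxM[OF S], of p q] commutative_bicommutant[OF S] pair[OF S] pq(3)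
      by (simp add: commutative_cstar_def)
    then show "\<not> (h p \<and> h q)"
      using consistent[OF S] pair[OF S] pq by blast
  next
    fix p q
    assume pq: "selfadjoint p" "selfadjoint q" "cmul A p q = cmul A q p" "h (cadd A p q)"
    then have S: "commuting {p, q}" by (simp add: commuting_pair)
    interpret B: unital_cstar_algebra "bicommutant_alg {p, q}"
      using unital[OF S] by unfold_locales
    \<comment> \<open>The sum lies in the bicommutant of the pair, so \<open>consistent\<close>
      judges it by the same ideal as both summands.\<close>
    have "cadd A p q \<notin> M {p, q}"
      using consistent[OF S _ selfadjoint_add[OF pq(1,2)]] B.add_closed[of p q] pair[OF S] pq(4) by simp
    then have "p \<notin> M {p, q} \<or> q \<notin> M {p, q}"
      using maxM[OF S] by (auto simp: maximal_ideal_def cstar_ideal_def)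
    then show "h p \<or> h q"
      using consistent[OF S] pair[OF S] pq by blast
  next
    fix p q
    assume pq: "selfadjoint p" "selfadjoint q" "cmul A p q = cmul A q p" "h (cmul A p q)"
    then have S: "commuting {p, q}" by (simp add: commuting_pair)
    interpret B: unital_cstar_algebra "bicommutant_alg {p, q}"
      using unital[OF S] by unfold_locales
    have "cmul A p q \<notin> M {p, q}"
      using consistent[OF S _ selfadjoint_mul[OF pq(1,2,3)]] B.mul_closed[of p q] pair[OF S] pq(4) by simp
    then have "p \<notin> M {p, q}"
      using maxM[OF S] pair[OF S] by (auto simp: maximal_ideal_def cstar_ideal_def)
    then show "h p"
      using consistent[OF S] pair[OF S] pq by blast
  next
    have S: "commuting {cone A}" by (simp add: commuting_def selfadjoint_def)
    interpret B: unital_cstar_algebra "bicommutant_alg {cone A}"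
      using unital[OF S] by unfold_locales
    show "h (cone A)" using B.maximal_ideal_one[OF maxM[OF S]] by (simp add: h_def)
  next
    have S: "commuting {czero A}" by (simp add: commuting_def selfadjoint_def)
    show "\<not> h (czero A)" using maxM[OF S] by (simp add: h_def maximal_ideal_def cstar_ideal_def)
  qed
qed

end

section \<open>The Kochen-Specker theorem\<close>

text \<open>The 33 rays with coordinates in \<open>{-2..2}\<close> come from a computer search that minimised the number
of constraints.\<close>

lemma no_ray_colouring:
  fixes h :: "real \<Rightarrow> real \<Rightarrow> real \<Rightarrow> bool"
  assumes orth: "\<And>a b c a' b' c'. a * a' + b * b' + c * c' = 0 \<Longrightarrow> \<not> (h a b c \<and> h a' b' c')"
    and basis: "\<And>a b c a' b' c' p q r k.
      \<lbrakk>a * a' + b * b' + c * c' = 0; a\<^sup>2 + b\<^sup>2 + c\<^sup>2 \<noteq> 0; a'\<^sup>2 + b'\<^sup>2 + c'\<^sup>2 \<noteq> 0; k \<noteq> 0;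
       b * c' - c * b' = k * p; c * a' - a * c' = k * q; a * b' - b * a' = k * r\<rbrakk>
      \<Longrightarrow> h a b c \<or> h a' b' c' \<or> h p q r"
  shows False
proof -
  \<comment> \<open>The orthogonal bases are grouped by the scalar \<open>k\<close> for which the
    cross product of the first two rays is \<open>k\<close> times the third; \<open>tm5\<close>
    stands for -5. The scalar lets each ray keep one fixed representative.\<close>
  have tm5:
    "h 0 1 2 \<or> h 0 2 (-1) \<or> h 1 0 0"
    by (rule basis[where k = "-5"]; simp)+
  have tm3:
    "h 1 (-1) (-2) \<or> h 1 (-1) 1 \<or> h 1 1 0"
    "h 1 (-1) (-1) \<or> h 1 (-1) 2 \<or> h 1 1 0"
    by (rule basis[where k = "-3"]; simp)+
  have tm2:
    "h 1 (-2) (-1) \<or> h 1 0 1 \<or> h 1 1 (-1)"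
    by (rule basis[where k = "-2"]; simp)+
  have tm1:
    "h 0 0 1 \<or> h 0 1 0 \<or> h 1 0 0"
    "h 0 1 (-1) \<or> h 1 (-1) (-1) \<or> h 2 1 1"
    "h 0 1 0 \<or> h 1 0 (-2) \<or> h 2 0 1"
    "h 0 1 0 \<or> h 1 0 (-1) \<or> h 1 0 1"
    "h 0 1 1 \<or> h 1 1 (-1) \<or> h 2 (-1) 1"
    "h 1 (-1) (-1) \<or> h 1 0 1 \<or> h 1 2 (-1)"
    by (rule basis[where k = "-1"]; simp)+
  have t1:
    "h 0 0 1 \<or> h 1 (-1) 0 \<or> h 1 1 0"
    "h 0 1 (-1) \<or> h 1 1 1 \<or> h 2 (-1) (-1)"
    "h 0 1 0 \<or> h 1 0 2 \<or> h 2 0 (-1)"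
    "h 0 1 1 \<or> h 1 (-1) 1 \<or> h 2 1 (-1)"
    "h 1 (-1) 0 \<or> h 1 1 (-1) \<or> h 1 1 2"
    "h 1 (-1) 1 \<or> h 1 0 (-1) \<or> h 1 2 1"
    by (rule basis[where k = "1"]; simp)+
  have t2:
    "h 0 1 (-1) \<or> h 0 1 1 \<or> h 1 0 0"
    "h 1 (-2) 1 \<or> h 1 0 (-1) \<or> h 1 1 1"
    "h 1 (-1) 0 \<or> h 1 1 (-2) \<or> h 1 1 1"
    by (rule basis[where k = "2"]; simp)+
  have t5:
    "h 0 1 (-2) \<or> h 0 2 1 \<or> h 1 0 0"
    by (rule basis[where k = "5"]; simp)+
  have p:
    "\<not> (h 0 0 1 \<and> h 0 1 0)"
    "\<not> (h 0 0 1 \<and> h 1 (-1) 0)"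
    "\<not> (h 0 0 1 \<and> h 1 0 0)"
    "\<not> (h 0 0 1 \<and> h 1 1 0)"
    "\<not> (h 0 1 (-2) \<and> h 1 (-2) (-1))"
    "\<not> (h 0 1 (-2) \<and> h 1 2 1)"
    "\<not> (h 0 1 (-1) \<and> h 0 1 1)"
    "\<not> (h 0 1 (-1) \<and> h 1 (-1) (-1))"
    "\<not> (h 0 1 (-1) \<and> h 1 0 0)"
    "\<not> (h 0 1 (-1) \<and> h 1 1 1)"
    "\<not> (h 0 1 0 \<and> h 1 0 (-1))"
    "\<not> (h 0 1 0 \<and> h 1 0 0)"
    "\<not> (h 0 1 0 \<and> h 1 0 1)"
    "\<not> (h 0 1 1 \<and> h 1 (-1) 1)"
    "\<not> (h 0 1 1 \<and> h 1 0 0)"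
    "\<not> (h 0 1 1 \<and> h 1 1 (-1))"
    "\<not> (h 0 1 2 \<and> h 1 (-2) 1)"
    "\<not> (h 0 1 2 \<and> h 1 2 (-1))"
    "\<not> (h 0 2 (-1) \<and> h 1 (-1) (-2))"
    "\<not> (h 0 2 (-1) \<and> h 1 1 2)"
    "\<not> (h 0 2 1 \<and> h 1 (-1) 2)"
    "\<not> (h 0 2 1 \<and> h 1 1 (-2))"
    "\<not> (h 1 (-1) (-2) \<and> h 2 0 1)"
    "\<not> (h 1 (-1) (-1) \<and> h 1 0 1)"
    "\<not> (h 1 (-1) (-1) \<and> h 1 1 0)"
    "\<not> (h 1 (-1) 0 \<and> h 1 1 (-1))"
    "\<not> (h 1 (-1) 0 \<and> h 1 1 0)"
    "\<not> (h 1 (-1) 0 \<and> h 1 1 1)"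
    "\<not> (h 1 (-1) 1 \<and> h 1 0 (-1))"
    "\<not> (h 1 (-1) 1 \<and> h 1 1 0)"
    "\<not> (h 1 (-1) 2 \<and> h 2 0 (-1))"
    "\<not> (h 1 0 (-2) \<and> h 2 (-1) 1)"
    "\<not> (h 1 0 (-2) \<and> h 2 1 1)"
    "\<not> (h 1 0 (-1) \<and> h 1 1 1)"
    "\<not> (h 1 0 1 \<and> h 1 1 (-1))"
    "\<not> (h 1 0 2 \<and> h 2 (-1) (-1))"
    "\<not> (h 1 0 2 \<and> h 2 1 (-1))"
    "\<not> (h 1 1 (-2) \<and> h 2 0 1)"
    "\<not> (h 1 1 2 \<and> h 2 0 (-1))"
    by (rule orth; simp)+
  \<comment> \<open>With each ray read as a propositional atom, the listed clauses are jointly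
    unsatisfiable.\<close>
  show False using tm5 tm3 tm2 tm1 t1 t2 t5 p by sat
qed

section \<open>Hermitian matrices and coordinate projections\<close>

definition hermitian :: "nat \<Rightarrow> (nat \<Rightarrow> nat \<Rightarrow> complex) \<Rightarrow> bool" where
  "hermitian n P \<longleftrightarrow> (\<forall>r s. (n \<le> r \<or> n \<le> s \<longrightarrow> P r s = 0) \<and> cnj (P s r) = P r s)"

lemma hermitian_carrier: "hermitian n P \<Longrightarrow> P \<in> cset (mat_alg n)"
  by (simp add: hermitian_def mat_alg_def)

lemma hermitian_inv: "hermitian n P \<Longrightarrow> cinv (mat_alg n) P = P"
  by (auto simp: hermitian_def mat_alg_def fun_eq_iff)

lemma hermitian_add:
  "\<lbrakk>hermitian n P; hermitian n Q\<rbrakk> \<Longrightarrow> hermitian n (cadd (mat_alg n) P Q)"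
  unfolding hermitian_def by (auto simp: mat_alg_def)

lemma mat_mul_add_left: "cmul (mat_alg n) (cadd (mat_alg n) P Q) R
    = cadd (mat_alg n) (cmul (mat_alg n) P R) (cmul (mat_alg n) Q R)"
  by (simp add: mat_alg_def fun_eq_iff distrib_right sum.distrib)

lemma mat_mul_add_right: "cmul (mat_alg n) P (cadd (mat_alg n) Q R)
    = cadd (mat_alg n) (cmul (mat_alg n) P Q) (cmul (mat_alg n) P R)"
  by (simp add: mat_alg_def fun_eq_iff distrib_left sum.distrib)

definition diag_mat :: "nat set \<Rightarrow> nat \<Rightarrow> nat \<Rightarrow> complex" where
  "diag_mat I = (\<lambda>r s. if r = s \<and> r \<in> I then 1 else 0)"

lemma hermitian_diag_mat: "I \<subseteq> {..<n} \<Longrightarrow> hermitian n (diag_mat I)"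
  by (auto simp: hermitian_def diag_mat_def)

lemma mul_diag_mat:
  assumes "I \<subseteq> {..<n}"
  shows "cmul (mat_alg n) (diag_mat I) (diag_mat J) = diag_mat (I \<inter> J)"
proof -
  have "(\<Sum>j<n. diag_mat I r j * diag_mat J j s) = (\<Sum>j<n. if j = r then diag_mat (I \<inter> J) r s else 0)" for r s
    by (rule sum.cong) (auto simp: diag_mat_def)
  with assms show ?thesis
    by (auto simp: mat_alg_def fun_eq_iff diag_mat_def)
qed

lemma add_diag_mat:
  "I \<inter> J = {} \<Longrightarrow> cadd (mat_alg n) (diag_mat I) (diag_mat J) = diag_mat (I \<union> J)"
  by (auto simp: mat_alg_def fun_eq_iff diag_mat_def)

section \<open>Rank-one projections supported on three coordinates\<close>

definition supp3 :: "nat \<Rightarrow> nat \<Rightarrow> nat \<Rightarrow> real \<Rightarrow> real \<Rightarrow> real \<Rightarrow> nat \<Rightarrow> real" where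
  "supp3 i j k a b c = (\<lambda>r. if r = i then a else if r = j then b else if r = k then c else 0)"

text \<open>For \<open>a = b = c = 0\<close> the division by zero makes this the zero matrix.\<close>

definition ray :: "nat \<Rightarrow> nat \<Rightarrow> nat \<Rightarrow> real \<Rightarrow> real \<Rightarrow> real \<Rightarrow> nat \<Rightarrow> nat \<Rightarrow> complex" where
  "ray i j k a b c =
     (\<lambda>r s. of_real (supp3 i j k a b c r * supp3 i j k a b c s / (a\<^sup>2 + b\<^sup>2 + c\<^sup>2)))"

lemma hermitian_ray: "\<lbrakk>i < n; j < n; k < n\<rbrakk> \<Longrightarrow> hermitian n (ray i j k a b c)"
  by (auto simp: hermitian_def ray_def supp3_def)

lemma sum_supp3:
  assumes "i < n" "j < n" "k < n" "i \<noteq> j" "i \<noteq> k" "j \<noteq> k"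
  shows "(\<Sum>r<n. supp3 i j k a b c r * supp3 i j k a' b' c' r) = a * a' + b * b' + c * c'"
proof -
  have "(\<Sum>r<n. supp3 i j k a b c r * supp3 i j k a' b' c' r)
      = (\<Sum>r\<in>{i, j, k}. supp3 i j k a b c r * supp3 i j k a' b' c' r)"
    by (rule sum.mono_neutral_right) (use assms in \<open>auto simp: supp3_def\<close>)
  with assms show ?thesis by (simp add: supp3_def)
qed

text \<open>The product of the rank-one matrices of \<open>u\<close> and \<open>v\<close> carries
  the inner product of \<open>u\<close> and \<open>v\<close> as a scalar factor.\<close>

lemma mul_ray_orthogonal:
  assumes "i < n" "j < n" "k < n" "i \<noteq> j" "i \<noteq> k" "j \<noteq> k"
    and "a * a' + b * b' + c * c' = 0"
  shows "cmul (mat_alg n) (ray i j k a b c) (ray i j k a' b' c') = czero (mat_alg n)"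
proof -
  have "(\<Sum>t<n. ray i j k a b c r t * ray i j k a' b' c' t s) = 0" for r s
  proof -
    \<comment> \<open>\<open>?c\<close> collects the factors that do not depend on the summation
      index, leaving the inner product of \<open>sum_supp3\<close>.\<close>
    let ?c = "supp3 i j k a b c r / (a\<^sup>2 + b\<^sup>2 + c\<^sup>2) * (supp3 i j k a' b' c' s / (a'\<^sup>2 + b'\<^sup>2 + c'\<^sup>2))"
    have "(\<Sum>t<n. ray i j k a b c r t * ray i j k a' b' c' t s)
      = of_real (\<Sum>t<n. ?c * (supp3 i j k a b c t * supp3 i j k a' b' c' t))"
      unfolding of_real_sum ray_def of_real_mult[symmetric]
      by (intro sum.cong arg_cong[where f = of_real]) (simp_all add: field_simps)
    also have "\<dots> = of_real (?c * (a * a' + b * b' + c * c'))"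
      by (simp only: sum_distrib_left[symmetric] sum_supp3[OF assms(1-6)])
    finally show ?thesis by (simp add: assms(7))
  qed
  then show ?thesis by (simp add: mat_alg_def fun_eq_iff)
qed

text \<open>Two orthogonal nonzero vectors and their cross product form an orthogonal basis of
  three-space, so the projections onto the three lines add up to the identity there.\<close>

lemma add_ray_basis:
  assumes d: "i \<noteq> j" "i \<noteq> k" "j \<noteq> k" and o: "a * a' + b * b' + c * c' = 0"
    and nz: "a\<^sup>2 + b\<^sup>2 + c\<^sup>2 \<noteq> 0" "a'\<^sup>2 + b'\<^sup>2 + c'\<^sup>2 \<noteq> 0" "m \<noteq> 0"
    and x: "b * c' - c * b' = m * p" "c * a' - a * c' = m * q" "a * b' - b * a' = m * r"
  shows "cadd (mat_alg n) (ray i j k a b c) (cadd (mat_alg n) (ray i j k a' b' c') (ray i j k p q r))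
      = diag_mat {i, j, k}"
proof -
  define N N' where "N = a\<^sup>2 + b\<^sup>2 + c\<^sup>2" and "N' = a'\<^sup>2 + b'\<^sup>2 + c'\<^sup>2"
  \<comment> \<open>Lagrange's identity: the squared length of the cross product of orthogonal
    vectors is the product of their squared lengths.\<close>
  have lagrange: "m\<^sup>2 * (p\<^sup>2 + q\<^sup>2 + r\<^sup>2) = N * N'"
  proof -
    have "m\<^sup>2 * (p\<^sup>2 + q\<^sup>2 + r\<^sup>2) = (m * p)\<^sup>2 + (m * q)\<^sup>2 + (m * r)\<^sup>2"
      by (simp add: algebra_simps power2_eq_square)
    also have "\<dots> = N * N'"
      unfolding N_def N'_def x[symmetric] using o by algebra
    finally show ?thesis .
  qed
  \<comment> \<open>Scaling the third vector by \<open>m\<close> gives its projection the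
    denominator \<open>N * N'\<close>, so clearing denominators leaves polynomial
    identities.\<close>
  have third: "y * z / (p\<^sup>2 + q\<^sup>2 + r\<^sup>2) = (m * y) * (m * z) / (N * N')" for y z
    unfolding lagrange[symmetric] using nz(3) by (simp add: power2_eq_square)
  have nz': "N \<noteq> 0" "N' \<noteq> 0" using nz by (simp_all add: N_def N'_def)
  have entry: "y * z / N + (y' * z' / N' + u * v / (p\<^sup>2 + q\<^sup>2 + r\<^sup>2)) = e"
    if "y * z * N' + y' * z' * N + (m * u) * (m * v) = e * (N * N')" for y z y' z' u v e
    unfolding third using nz' that by (simp add: field_simps)
  \<comment> \<open>The nine entries of the resolution of the identity, multiplied by
    \<open>N * N'\<close>.\<close>
  have ids:
    "a * a * N' + a' * a' * N + m * p * (m * p) = N * N'"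
    "a * b * N' + a' * b' * N + m * p * (m * q) = 0"
    "a * c * N' + a' * c' * N + m * p * (m * r) = 0"
    "b * a * N' + b' * a' * N + m * q * (m * p) = 0"
    "b * b * N' + b' * b' * N + m * q * (m * q) = N * N'"
    "b * c * N' + b' * c' * N + m * q * (m * r) = 0"
    "c * a * N' + c' * a' * N + m * r * (m * p) = 0"
    "c * b * N' + c' * b' * N + m * r * (m * q) = 0"
    "c * c * N' + c' * c' * N + m * r * (m * r) = N * N'"
    unfolding N_def N'_def x[symmetric] using o by algebra+
  show ?thesis
    unfolding ray_def diag_mat_def N_def[symmetric] N'_def[symmetric]
  proof (intro ext)
    fix s t
    \<comment> \<open>Over the reals, an entry either lies at one of the nine positions of
      \<open>ids\<close> or has an index outside the three coordinates, where everything
      vanishes.\<close>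
    have "supp3 i j k a b c s * supp3 i j k a b c t / N +
        (supp3 i j k a' b' c' s * supp3 i j k a' b' c' t / N' +
         supp3 i j k p q r s * supp3 i j k p q r t / (p\<^sup>2 + q\<^sup>2 + r\<^sup>2))
        = (if s = t \<and> s \<in> {i, j, k} then 1 else 0)"
      by (rule entry, cases "s = i"; cases "s = j"; cases "s = k"; cases "t = i"; cases "t = j"; cases "t = k")
         (simp_all add: supp3_def d d[symmetric] ids)
    from arg_cong[OF this, of complex_of_real] show "cadd (mat_alg n)
        (\<lambda>s t. of_real (supp3 i j k a b c s * supp3 i j k a b c t / N))
        (cadd (mat_alg n) (\<lambda>s t. of_real (supp3 i j k a' b' c' s * supp3 i j k a' b' c' t / N'))
          (\<lambda>s t. of_real (supp3 i j k p q r s * supp3 i j k p q r t / (p\<^sup>2 + q\<^sup>2 + r\<^sup>2)))) s t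
      = (if s = t \<and> s \<in> {i, j, k} then 1 else 0)"
      by (simp add: mat_alg_def if_distrib[of complex_of_real] cong: if_cong split del: if_split)
  qed
qed

text \<open>Once a coordinate projection of rank three is true, \<open>orth\<close> forbids two true
  orthogonal rays and \<open>add\<close> makes some ray of each basis true, as
  \<open>no_ray_colouring\<close> demands.\<close>

theorem kochen_specker:
  fixes h :: "(nat \<Rightarrow> nat \<Rightarrow> complex) \<Rightarrow> bool"
  assumes n: "n \<ge> 3"
    and orth: "\<And>P Q. \<lbrakk>hermitian n P; hermitian n Q; cmul (mat_alg n) P Q = czero (mat_alg n);
      cmul (mat_alg n) Q P = czero (mat_alg n)\<rbrakk> \<Longrightarrow> \<not> (h P \<and> h Q)"
    and add: "\<And>P Q. \<lbrakk>hermitian n P; hermitian n Q; cmul (mat_alg n) P Q = cmul (mat_alg n) Q P;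
      h (cadd (mat_alg n) P Q)\<rbrakk> \<Longrightarrow> h P \<or> h Q"
    and mul: "\<And>P Q. \<lbrakk>hermitian n P; hermitian n Q; cmul (mat_alg n) P Q = cmul (mat_alg n) Q P;
      h (cmul (mat_alg n) P Q)\<rbrakk> \<Longrightarrow> h P"
    and one: "h (cone (mat_alg n))" and zero: "\<not> h (czero (mat_alg n))"
  shows False
proof -
  \<comment> \<open>Induction peels one diagonal unit at a time off a true projection;
    \<open>m = n\<close> starts from the matrix unit.\<close>
  have ex: "\<exists>i<m. h (diag_mat {i})" if "m \<le> n" "h (diag_mat {..<m})" for m
    using that
  proof (induction m)
    case 0
    moreover have "diag_mat {} = czero (mat_alg n)" by (simp add: diag_mat_def mat_alg_def)
    ultimately show ?case using zero by simp
  next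
    case (Suc m)
    have "diag_mat {..<Suc m} = cadd (mat_alg n) (diag_mat {..<m}) (diag_mat {m})"
      by (subst add_diag_mat) (auto simp: lessThan_Suc)
    then have "h (diag_mat {..<m}) \<or> h (diag_mat {m})"
      using Suc.prems by (intro add) (auto simp: mul_diag_mat Int_commute intro!: hermitian_diag_mat)
    then show ?case using Suc less_Suc_eq by auto
  qed
  have "diag_mat {..<n} = cone (mat_alg n)"
    by (simp add: diag_mat_def mat_alg_def fun_eq_iff)
  with ex[of n] one obtain i where i: "i < n" "h (diag_mat {i})" by auto
  obtain j k where jk: "j < n" "k < n" "i \<noteq> j" "i \<noteq> k" "j \<noteq> k"
  proof -
    consider "i = 0" | "i = 1" | "i \<noteq> 0" "i \<noteq> 1" by blast
    then show thesis
      using n that[of 1 2] that[of 0 2] that[of 0 1] by cases auto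
  qed
  note ijk = i(1) jk
  \<comment> \<open>Multiplying by \<open>diag_mat {i}\<close> gives back the true
    \<open>diag_mat {i}\<close>, so the larger factor is true by \<open>mul\<close>.\<close>
  have hQ: "h (diag_mat {i, j, k})"
  proof (rule mul[where Q = "diag_mat {i}"])
    show "h (cmul (mat_alg n) (diag_mat {i, j, k}) (diag_mat {i}))"
      using i ijk by (subst mul_diag_mat) auto
  qed (use ijk in \<open>auto simp: mul_diag_mat intro!: hermitian_diag_mat\<close>)
  note herm = hermitian_ray[OF \<open>i < n\<close> \<open>j < n\<close> \<open>k < n\<close>]
  show False
  proof (rule no_ray_colouring[of "\<lambda>a b c. h (ray i j k a b c)"])
    fix a b c a' b' c' :: real
    assume "a * a' + b * b' + c * c' = 0"
    then show "\<not> (h (ray i j k a b c) \<and> h (ray i j k a' b' c'))"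
      using ijk by (intro orth herm mul_ray_orthogonal) (auto simp: algebra_simps)
  next
    fix a b c a' b' c' p q r m :: real
    assume o: "a * a' + b * b' + c * c' = 0"
      and nz: "a\<^sup>2 + b\<^sup>2 + c\<^sup>2 \<noteq> 0" "a'\<^sup>2 + b'\<^sup>2 + c'\<^sup>2 \<noteq> 0" "m \<noteq> 0"
      and x: "b * c' - c * b' = m * p" "c * a' - a * c' = m * q" "a * b' - b * a' = m * r"
    let ?U = "ray i j k a b c" and ?V = "ray i j k a' b' c'" and ?W = "ray i j k p q r"
    have sum: "cadd (mat_alg n) ?U (cadd (mat_alg n) ?V ?W) = diag_mat {i, j, k}"
      by (rule add_ray_basis[OF ijk(4-6) o nz x])
    \<comment> \<open>The third vector is a rescaled cross product, hence orthogonal to the other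
      two; the nonzero \<open>m\<close> is cancelled.\<close>
    have "m * (a * p + b * q + c * r) = a * (m * p) + b * (m * q) + c * (m * r)"
      by (simp add: algebra_simps)
    also have "\<dots> = 0" unfolding x[symmetric] by (simp add: algebra_simps)
    finally have UW: "a * p + b * q + c * r = 0" using nz by simp
    have "m * (a' * p + b' * q + c' * r) = a' * (m * p) + b' * (m * q) + c' * (m * r)"
      by (simp add: algebra_simps)
    also have "\<dots> = 0" unfolding x[symmetric] by (simp add: algebra_simps)
    finally have VW: "a' * p + b' * q + c' * r = 0" using nz by simp
    note mul0 = mul_ray_orthogonal[OF ijk(1-6)]
    have comm: "cmul (mat_alg n) P (cadd (mat_alg n) Q R) = cmul (mat_alg n) (cadd (mat_alg n) Q R) P"
      if "cmul (mat_alg n) P Q = czero (mat_alg n)" "cmul (mat_alg n) P R = czero (mat_alg n)"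
        "cmul (mat_alg n) Q P = czero (mat_alg n)" "cmul (mat_alg n) R P = czero (mat_alg n)" for P Q R
      using that by (simp add: mat_mul_add_left mat_mul_add_right)
    \<comment> \<open>The true projection is split as \<open>?U\<close> plus the rest, then the rest
      as \<open>?V\<close> plus \<open>?W\<close>. The summands commute each time because their
      products vanish in both orders.\<close>
    have "h ?U \<or> h (cadd (mat_alg n) ?V ?W)"
      using o UW hQ by (intro add herm hermitian_add comm mul0) (auto simp: sum mult.commute)
    moreover have "h ?V \<or> h ?W" if "h (cadd (mat_alg n) ?V ?W)"
      using VW that by (intro add herm) (auto simp: mul0 mult.commute)
    ultimately show "h ?U \<or> h ?V \<or> h ?W" by blast
  qed
qed

section \<open>Functors extending the Gelfand spectrum\<close>

text \<open>The functor sees only algebras with carrier in \<open>'a\<close>, so the matrix algebra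
  enters through an isomorphic copy \<open>A\<close>. A point of \<open>Fo A\<close> colours
  \<open>A\<close>, and the inverse isomorphism carries the colouring to matrices.\<close>

theorem theorem1p2:
  fixes Fo :: "'a cstar_alg \<Rightarrow> 'b set"
    and Fm :: "'a cstar_alg \<Rightarrow> 'a cstar_alg \<Rightarrow> ('a \<Rightarrow> 'a) \<Rightarrow> 'b \<Rightarrow> 'b"
    and A :: "'a cstar_alg" and n :: nat
  assumes "contra_functor Fo Fm"
    and "restricts_to_Gelf Fo Fm"
    and "n \<ge> 3"
    and "unital_cstar A"
    and "cstar_iso A (mat_alg n)"
  shows "Fo A = {}"
proof (rule ccontr)
  assume "Fo A \<noteq> {}"
  then obtain x where x: "x \<in> Fo A" by blast
  interpret unital_cstar_algebra A using assms(4) by unfold_locales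
  obtain h where h:
    "\<And>p q. \<lbrakk>selfadjoint p; selfadjoint q; cmul A p q = czero A; cmul A q p = czero A\<rbrakk> \<Longrightarrow> \<not> (h p \<and> h q)"
    "\<And>p q. \<lbrakk>selfadjoint p; selfadjoint q; cmul A p q = cmul A q p; h (cadd A p q)\<rbrakk> \<Longrightarrow> h p \<or> h q"
    "\<And>p q. \<lbrakk>selfadjoint p; selfadjoint q; cmul A p q = cmul A q p; h (cmul A p q)\<rbrakk> \<Longrightarrow> h p"
    "h (cone A)" "\<not> h (czero A)"
    using spectrum_point_colouring[OF assms(1,2) x] by blast
  obtain f where f: "f \<in> cstar_hom A (mat_alg n)" and bij: "bij_betw f (cset A) (cset (mat_alg n))"
    using assms(5) by (auto simp: cstar_iso_def)
  define g where "g = inv_into (cset A) f"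
  have gf: "g (f a) = a" if "a \<in> cset A" for a
    using bij that by (simp add: g_def bij_betw_inv_into_left)
  have fg: "f (g P) = P" "g P \<in> cset A" if "P \<in> cset (mat_alg n)" for P
    using bij that by (simp_all add: g_def bij_betw_inv_into_right bij_betw_apply[OF bij_betw_inv_into])
  have f_hom:
    "f (cadd A a b) = cadd (mat_alg n) (f a) (f b)" "f (cmul A a b) = cmul (mat_alg n) (f a) (f b)"
    "f (cinv A a) = cinv (mat_alg n) (f a)" "f (csmul A c a) = csmul (mat_alg n) c (f a)"
    if "a \<in> cset A" "b \<in> cset A" for a b c
    using f that by (simp_all add: cstar_hom_def)
  \<comment> \<open>The inverse inherits each operation by applying \<open>gf\<close> to the result
    computed in \<open>A\<close>.\<close>
  have g_add: "g (cadd (mat_alg n) P Q) = cadd A (g P) (g Q)"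
    and g_mul: "g (cmul (mat_alg n) P Q) = cmul A (g P) (g Q)"
    if "P \<in> cset (mat_alg n)" "Q \<in> cset (mat_alg n)" for P Q
    using gf[of "cadd A (g P) (g Q)"] gf[of "cmul A (g P) (g Q)"] that by (simp_all add: f_hom fg)
  have g_self: "selfadjoint (g P)" if "hermitian n P" for P
    using gf[of "cinv A (g P)"] fg[OF hermitian_carrier[OF that]] hermitian_inv[OF that]
    by (simp add: selfadjoint_def f_hom)
  have g_one: "g (cone (mat_alg n)) = cone A"
    using gf[of "cone A"] f by (simp add: cstar_hom_def)
  \<comment> \<open>Preservation of zero comes from homogeneity with the scalar 0.\<close>
  have "f (czero A) = czero (mat_alg n)"
    using f_hom(4)[of "czero A" "czero A" 0] by (simp add: mat_alg_def)
  then have g_zero: "g (czero (mat_alg n)) = czero A"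
    using gf[of "czero A"] by simp
  have g_commute: "cmul A (g P) (g Q) = cmul A (g Q) (g P)"
    if "hermitian n P" "hermitian n Q" "cmul (mat_alg n) P Q = cmul (mat_alg n) Q P" for P Q
    using that by (metis g_mul hermitian_carrier)
  show False
  proof (rule kochen_specker[where n = n and h = "\<lambda>P. h (g P)"])
    fix P Q
    assume H: "hermitian n P" "hermitian n Q"
      "cmul (mat_alg n) P Q = czero (mat_alg n)" "cmul (mat_alg n) Q P = czero (mat_alg n)"
    have "cmul A (g P) (g Q) = czero A" "cmul A (g Q) (g P) = czero A"
      unfolding g_mul[OF H(1,2)[THEN hermitian_carrier], symmetric]
        g_mul[OF H(2,1)[THEN hermitian_carrier], symmetric] H(3,4) g_zero by (rule refl)+
    then show "\<not> (h (g P) \<and> h (g Q))"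
      by (rule h(1)[OF g_self[OF H(1)] g_self[OF H(2)]])
  next
    fix P Q
    assume H: "hermitian n P" "hermitian n Q" "cmul (mat_alg n) P Q = cmul (mat_alg n) Q P"
      and "h (g (cadd (mat_alg n) P Q))"
    then have "h (cadd A (g P) (g Q))" by (simp add: g_add hermitian_carrier)
    then show "h (g P) \<or> h (g Q)"
      by (rule h(2)[OF g_self[OF H(1)] g_self[OF H(2)] g_commute[OF H]])
  next
    fix P Q
    assume H: "hermitian n P" "hermitian n Q" "cmul (mat_alg n) P Q = cmul (mat_alg n) Q P"
      and "h (g (cmul (mat_alg n) P Q))"
    then have "h (cmul A (g P) (g Q))" by (metis g_mul hermitian_carrier)
    then show "h (g P)"
      by (rule h(3)[OF g_self[OF H(1)] g_self[OF H(2)] g_commute[OF H]])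
  qed (use assms(3) h(4,5) g_one g_zero in auto)
qed

end
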